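(* There exist a convex body $K\subseteq\mathbb{R}^3$ and a countable family $\mathcal{F}$ of translates of $K$ such that $\operatorname{vcdim}(\mathcal{F})=\infty$.
   Context: A convex body in $\mathbb{R}^n$ is a compact convex set with non-empty interior. A translate of $K$ is a set $K+x$ with $x\in\mathbb{R}^3$. A set system $\mathcal{F}$ shatters a set of points $X$ if for every subset $X'\subseteq X$ there exists $F\in\mathcal{F}$ with $X\cap F=X'$. The VC-dimension of $\mathcal{F}$ is $\operatorname{vcdim}(\mathcal{F})=\sup\{\operatorname{card}(X) : \mathcal{F}\text{ shatters }X\}$, which is $\infty$ if there is no upper bound on the sizes of sets shattered by $\mathcal{F}$. *)

theory Defs
  imports "HOL-Analysis.Analysis" "HOL-Library.Extended_Nat"
begin

definition convex_body :: "'a::euclidean_space set \<Rightarrow> bool" where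
  "convex_body K \<longleftrightarrow> compact K \<and> convex K \<and> interior K \<noteq> {}"

definition translate_of :: "'a::ab_group_add set \<Rightarrow> 'a set \<Rightarrow> bool" where
  "translate_of K T \<longleftrightarrow> (\<exists>x. T = (\<lambda>k. k + x) ` K)"

definition shatters :: "'a set set \<Rightarrow> 'a set \<Rightarrow> bool" where
  "shatters \<F> X \<longleftrightarrow> (\<forall>X'\<subseteq>X. \<exists>F\<in>\<F>. X \<inter> F = X')"

(* The library's card is 0 on infinite sets, which would be wrong inside a supremum. *)
definition ecard :: "'a set \<Rightarrow> enat" where
  "ecard X = (if finite X then enat (card X) else \<infinity>)"

definition vcdim :: "'a set set \<Rightarrow> enat" where
  "vcdim \<F> = Sup {ecard X | X. shatters \<F> X}"

end

theory Submission
  imports Defs "HOL-Library.Nat_Bijection"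
begin

text \<open>
  The paraboloid \<open>z = x\<^sup>2 + y\<^sup>2\<close> is strictly convex, and it is a translation surface: the sum of a
  point \<open>(a, 0, a\<^sup>2)\<close> and a point \<open>(0, b, b\<^sup>2)\<close> lies on it again. So
  \<open>(a\<^sub>i, 0, a\<^sub>i\<^sup>2)\<close> belongs to the translate of a body \<open>K\<close> by \<open>-(0, b\<^sub>j, b\<^sub>j\<^sup>2)\<close> exactly if
  \<open>(a\<^sub>i, b\<^sub>j, a\<^sub>i\<^sup>2 + b\<^sub>j\<^sup>2)\<close> belongs to \<open>K\<close>. For
  \<open>a\<^sub>i = 2\<^sup>-\<^sup>i\<close> and \<open>b\<^sub>j = 2\<^sup>-\<^sup>j\<close> these points form a discrete subset of the paraboloid, and by strict
  convexity each of them can be cut off by a plane that is parallel to the tangent plane and so close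
  to it that all others stay. Removing such caps from a solid paraboloid of bounded height
  therefore prescribes the incidence of \<open>i\<close> and \<open>j\<close> arbitrarily. Prescribing that \<open>i\<close> lies in
  the \<open>j\<close>-th finite set of natural numbers, every finite subset of the points
  \<open>(a\<^sub>i, 0, a\<^sub>i\<^sup>2)\<close> is shattered by one sequence of translates.

  The half-space that removes the cap around the point over \<open>(a, b)\<close> is written
  \<open>z \<ge> 2ax + 2by - a\<^sup>2 - b\<^sup>2 + e\<close>. At a point of the paraboloid this inequality reads
  \<open>(x - a)\<^sup>2 + (y - b)\<^sup>2 \<ge> e\<close>, so the choice \<open>e = (ab/2)\<^sup>2\<close> is small
  enough because distinct powers \<open>a\<close> and \<open>x\<close> of one half differ by at least \<open>a/2\<close>.
\<close>

definition capped_paraboloid :: "(nat \<times> nat) set \<Rightarrow> (real ^ 3) set" where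
  "capped_paraboloid R =
     {v. (v$1)\<^sup>2 + (v$2)\<^sup>2 \<le> v$3 \<and> v$3 \<le> 10 \<and>
         (\<forall>(i, j) \<in> - R. 2 * (1/2)^i * v$1 + 2 * (1/2)^j * v$2 - ((1/2)^i)\<^sup>2 - ((1/2)^j)\<^sup>2
             + ((1/2)^i * (1/2)^j / 2)\<^sup>2 \<le> v$3)}"

lemma capped_paraboloid_alt:
  "capped_paraboloid R =
     {v. (v$1)\<^sup>2 + (v$2)\<^sup>2 \<le> v$3} \<inter> {v. v$3 \<le> 10} \<inter>
     (\<Inter>(i, j) \<in> - R. {v. 2 * (1/2)^i * v$1 + 2 * (1/2)^j * v$2 - ((1/2)^i)\<^sup>2 - ((1/2)^j)\<^sup>2
             + ((1/2)^i * (1/2)^j / 2)\<^sup>2 \<le> v$3})"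
  by (auto simp: capped_paraboloid_def)

lemma closed_capped_paraboloid: "closed (capped_paraboloid R)"
  unfolding capped_paraboloid_alt
  by (intro closed_Int closed_INT ballI)
     (auto intro!: closed_Collect_le continuous_intros split: prod.splits)

lemma bounded_capped_paraboloid: "bounded (capped_paraboloid R)"
proof -
  have "norm v \<le> 18" if "v \<in> capped_paraboloid R" for v
  proof -
    have v: "(v$1)\<^sup>2 + (v$2)\<^sup>2 \<le> v$3" "v$3 \<le> 10"
      using that by (auto simp: capped_paraboloid_def)
    have "0 \<le> (v$1)\<^sup>2" "0 \<le> (v$2)\<^sup>2" by simp_all
    then have "(v$1)\<^sup>2 \<le> 16 \<and> (v$2)\<^sup>2 \<le> 16 \<and> 0 \<le> v$3"
      using v by linarith
    then have "\<bar>v$1\<bar> \<le> 4" "\<bar>v$2\<bar> \<le> 4" "\<bar>v$3\<bar> \<le> 10"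
      using v(2) abs_le_square_iff[of "v$1" 4] abs_le_square_iff[of "v$2" 4] by simp_all
    then show ?thesis
      using norm_le_l1_cart[of v] by (simp add: sum_3)
  qed
  then show ?thesis by (auto simp: bounded_iff)
qed

lemma convex_capped_paraboloid: "convex (capped_paraboloid R)"
proof -
  have sq: "(u * a + w * b)\<^sup>2 \<le> u * a\<^sup>2 + w * b\<^sup>2"
    if "0 \<le> u" "0 \<le> w" "u + w = 1" for u w a b :: real
    using convex_power2 that unfolding convex_on_def by (auto simp: algebra_simps)
  have "convex {v :: real^3. (v$1)\<^sup>2 + (v$2)\<^sup>2 \<le> v$3}"
  proof (rule convexI)
    fix v w :: "real^3" and s t :: real
    assume v: "v \<in> {v. (v$1)\<^sup>2 + (v$2)\<^sup>2 \<le> v$3}" and w: "w \<in> {v. (v$1)\<^sup>2 + (v$2)\<^sup>2 \<le> v$3}"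
      and st: "0 \<le> s" "0 \<le> t" "s + t = 1"
    have "s * ((v$1)\<^sup>2 + (v$2)\<^sup>2) \<le> s * v$3" "t * ((w$1)\<^sup>2 + (w$2)\<^sup>2) \<le> t * w$3"
      using v w st by (auto intro: mult_left_mono)
    then show "s *\<^sub>R v + t *\<^sub>R w \<in> {v. (v$1)\<^sup>2 + (v$2)\<^sup>2 \<le> v$3}"
      using sq[OF st, of "v$1" "w$1"] sq[OF st, of "v$2" "w$2"] by (simp add: distrib_left)
  qed
  moreover have "convex {v :: real^3. a * v$1 + b * v$2 - c - d + e \<le> v$3}" for a b c d e :: real
  proof -
    have "{v :: real^3. a * v$1 + b * v$2 - c - d + e \<le> v$3}
        = {v. inner (vector [a, b, -1]) v \<le> c + d - e}"
      by (auto simp: inner_vec_def sum_3)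
    then show ?thesis by (simp only: convex_halfspace_le)
  qed
  moreover have "convex {v :: real^3. v$3 \<le> 10}"
    by (simp add: convex_def convex_bound_le)
  ultimately show ?thesis
    unfolding capped_paraboloid_alt
    by (intro convex_Int convex_INT) (auto split: prod.splits)
qed

text \<open>All removed caps stay at or below height 5 over the square \<open>[-1, 1]\<^sup>2\<close>, because the powers of
  one half are at most 1; so the unit ball around \<open>(0, 0, 7)\<close> survives.\<close>

lemma interior_capped_paraboloid: "interior (capped_paraboloid R) \<noteq> {}"
proof -
  define c :: "real^3" where "c = vector [0, 0, 7]"
  have "ball c 1 \<subseteq> capped_paraboloid R"
  proof
    fix v assume "v \<in> ball c 1"
    then have d: "\<bar>(v - c)$k\<bar> < 1" for k
      using component_le_norm_cart[of "v - c" k] by (simp add: dist_norm norm_minus_commute)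
    have v: "\<bar>v$1\<bar> \<le> 1" "\<bar>v$2\<bar> \<le> 1" "6 \<le> v$3" "v$3 \<le> 8"
      using d[of 1] d[of 2] d[of 3] by (auto simp: c_def)
    have "(v$1)\<^sup>2 \<le> 1" "(v$2)\<^sup>2 \<le> 1"
      using v by (auto simp: abs_square_le_1)
    moreover have "2 * (1/2)^i * v$1 + 2 * (1/2)^j * v$2 - ((1/2)^i)\<^sup>2 - ((1/2)^j)\<^sup>2
             + ((1/2)^i * (1/2)^j / 2)\<^sup>2 \<le> v$3" for i j :: nat
    proof -
      define a b :: real where "a = (1/2)^i" and "b = (1/2)^j"
      have ab: "0 \<le> a" "a \<le> 1" "0 \<le> b" "b \<le> 1"
        by (auto simp: a_def b_def power_le_one)
      have "a * v$1 \<le> a * 1" "b * v$2 \<le> b * 1"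
        using v ab by (simp_all only: mult_left_mono abs_le_iff)
      moreover have "(a * b / 2)\<^sup>2 \<le> 1"
        using ab mult_le_one[of a b] by (simp add: abs_square_le_1)
      ultimately have "2 * a * v$1 + 2 * b * v$2 - a\<^sup>2 - b\<^sup>2 + (a * b / 2)\<^sup>2 \<le> v$3"
        using ab v zero_le_power2[of a] zero_le_power2[of b] by linarith
      then show ?thesis by (simp add: a_def b_def)
    qed
    ultimately show "v \<in> capped_paraboloid R"
      using v by (auto simp: capped_paraboloid_def)
  qed
  then have "ball c 1 \<subseteq> interior (capped_paraboloid R)"
    by (simp add: interior_maximal)
  moreover have "c \<in> ball c 1" by simp
  ultimately show ?thesis by blast
qed

lemma convex_body_capped_paraboloid: "convex_body (capped_paraboloid R)"
  by (simp add: convex_body_def compact_eq_bounded_closed closed_capped_paraboloid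
      bounded_capped_paraboloid convex_capped_paraboloid interior_capped_paraboloid)

lemma half_power_gap:
  fixes i k :: nat
  assumes "i \<noteq> k"
  shows "((1/2)^i / 2)\<^sup>2 \<le> ((1/2)^k - (1/2)^i :: real)\<^sup>2"
proof -
  have step: "(1/2)^n \<le> ((1/2)^m / 2 :: real)" if "m < n" for m n :: nat
    using power_decreasing[of "Suc m" n "1/2 :: real"] that by simp
  have pos: "0 < (1/2 :: real)^i" "0 < (1/2 :: real)^k" by auto
  have "(1/2)^i / 2 \<le> \<bar>(1/2)^k - (1/2)^i :: real\<bar>"
    using step[of i k] step[of k i] assms pos by (cases i k rule: linorder_cases) linarith+
  then show ?thesis
    by (simp add: abs_le_square_iff[symmetric])
qed

definition paraboloid_point :: "nat \<Rightarrow> nat \<Rightarrow> real ^ 3" where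
  "paraboloid_point i j = vector [(1/2)^i, (1/2)^j, ((1/2)^i)\<^sup>2 + ((1/2)^j)\<^sup>2]"

text \<open>The half-space belonging to \<open>(i, j)\<close> excludes its own point, because its boundary plane is
  the tangent plane raised by a positive amount \<open>e\<close>. For any other point one of the two indices
  differs, and the squared gap in that coordinate alone is already at least \<open>e\<close>.\<close>

lemma paraboloid_point_in_capped_iff:
  "paraboloid_point i j \<in> capped_paraboloid R \<longleftrightarrow> (i, j) \<in> R"
proof
  assume K: "paraboloid_point i j \<in> capped_paraboloid R"
  show "(i, j) \<in> R"
  proof (rule ccontr)
    assume "(i, j) \<notin> R"
    then have "2 * (1/2)^i * (1/2)^i + 2 * (1/2)^j * (1/2)^j - ((1/2)^i)\<^sup>2 - ((1/2)^j)\<^sup>2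
        + ((1/2)^i * (1/2)^j / 2)\<^sup>2 \<le> ((1/2)^i)\<^sup>2 + ((1/2 :: real)^j)\<^sup>2"
      using K by (force simp: capped_paraboloid_def paraboloid_point_def)
    then have "((1/2)^i * (1/2)^j / 2 :: real)\<^sup>2 \<le> 0"
      by (simp add: power2_eq_square)
    then show False by simp
  qed
next
  assume R: "(i, j) \<in> R"
  have cut: "2 * (1/2)^k * (1/2)^i + 2 * (1/2)^l * (1/2)^j - ((1/2)^k)\<^sup>2 - ((1/2)^l)\<^sup>2
      + ((1/2)^k * (1/2)^l / 2)\<^sup>2 \<le> ((1/2)^i)\<^sup>2 + ((1/2 :: real)^j)\<^sup>2"
    if "(k, l) \<notin> R" for k l :: nat
  proof -
    define a b x y :: real where
      "a = (1/2)^k" and "b = (1/2)^l" and "x = (1/2)^i" and "y = (1/2)^j"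
    have ab: "0 \<le> a" "a \<le> 1" "0 \<le> b" "b \<le> 1"
      by (auto simp: a_def b_def power_le_one)
    have "(a * b / 2)\<^sup>2 \<le> (a / 2)\<^sup>2" "(a * b / 2)\<^sup>2 \<le> (b / 2)\<^sup>2"
      using ab by (auto intro!: power_mono simp: mult_left_le mult_left_le_one_le)
    moreover have "k \<noteq> i \<or> l \<noteq> j" using R that by auto
    then have "(a / 2)\<^sup>2 \<le> (x - a)\<^sup>2 \<or> (b / 2)\<^sup>2 \<le> (y - b)\<^sup>2"
      unfolding a_def b_def x_def y_def using half_power_gap by blast
    ultimately have "(a * b / 2)\<^sup>2 \<le> (x - a)\<^sup>2 + (y - b)\<^sup>2"
      using zero_le_power2[of "x - a"] zero_le_power2[of "y - b"] by linarith
    then have "2 * a * x + 2 * b * y - a\<^sup>2 - b\<^sup>2 + (a * b / 2)\<^sup>2 \<le> x\<^sup>2 + y\<^sup>2"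
      by (simp add: power2_diff algebra_simps)
    then show ?thesis by (simp add: a_def b_def x_def y_def)
  qed
  have "((1/2 :: real)^i)\<^sup>2 \<le> 1" "((1/2 :: real)^j)\<^sup>2 \<le> 1"
    by (auto intro!: power_le_one)
  with cut show "paraboloid_point i j \<in> capped_paraboloid R"
    by (auto simp: capped_paraboloid_def paraboloid_point_def)
qed

lemma vcdim_eq_infinity_if_separates_finite:
  fixes p :: "nat \<Rightarrow> 'a"
  assumes inj: "inj p"
    and sep: "\<And>S. finite S \<Longrightarrow> \<exists>F\<in>\<F>. \<forall>i. p i \<in> F \<longleftrightarrow> i \<in> S"
  shows "vcdim \<F> = \<infinity>"
proof -
  have "enat n \<le> vcdim \<F>" for n
  proof -
    have "shatters \<F> (p ` {..<n})"
      unfolding shatters_def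
    proof (intro allI impI)
      fix X' assume X': "X' \<subseteq> p ` {..<n}"
      obtain F where "F \<in> \<F>" and F: "\<forall>i. p i \<in> F \<longleftrightarrow> i \<in> {i. i < n \<and> p i \<in> X'}"
        using sep[of "{i. i < n \<and> p i \<in> X'}"] by auto
      moreover have "p ` {..<n} \<inter> F = X'"
        using X' F by auto
      ultimately show "\<exists>F\<in>\<F>. p ` {..<n} \<inter> F = X'" by blast
    qed
    moreover have "ecard (p ` {..<n}) = enat n"
      using inj by (simp add: ecard_def card_image inj_on_subset)
    ultimately show ?thesis
      unfolding vcdim_def by (intro Sup_upper) (auto intro!: exI[of _ "p ` {..<n}"])
  qed
  then show ?thesis
    by (metis enat_ord_simps(1) not_infinity_eq Suc_n_not_le_n)
qed

theorem mainTheorem4: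
  shows "\<exists>(K :: (real ^ 3) set) (\<F> :: (real ^ 3) set set).
           convex_body K \<and> countable \<F> \<and> (\<forall>T\<in>\<F>. translate_of K T) \<and> vcdim \<F> = \<infinity>"
proof -
  define K where "K = capped_paraboloid {(i, j). i \<in> set_decode j}"
  define p :: "nat \<Rightarrow> real^3" where "p i = vector [(1/2)^i, 0, ((1/2)^i)\<^sup>2]" for i
  define t :: "nat \<Rightarrow> real^3" where "t j = vector [0, (1/2)^j, ((1/2)^j)\<^sup>2]" for j
  define T where "T j = (\<lambda>k. k + - t j) ` K" for j
  have sum: "p i + t j = paraboloid_point i j" for i j
    by (simp add: p_def t_def paraboloid_point_def vec_eq_iff forall_3)
  have "p i \<in> T j \<longleftrightarrow> p i + t j \<in> K" for i j
    unfolding T_def by (force simp: image_iff algebra_simps)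
  then have mem: "p i \<in> T j \<longleftrightarrow> i \<in> set_decode j" for i j
    by (simp add: sum K_def paraboloid_point_in_capped_iff)
  have "inj p"
  proof (rule injI)
    fix i k assume "p i = p k"
    then have "p i $ 1 = p k $ 1" by simp
    then show "i = k" by (simp add: p_def power_inject_exp')
  qed
  then have "vcdim (range T) = \<infinity>"
  proof (rule vcdim_eq_infinity_if_separates_finite)
    fix S :: "nat set" assume "finite S"
    then show "\<exists>F\<in>range T. \<forall>i. p i \<in> F \<longleftrightarrow> i \<in> S"
      by (intro bexI[of _ "T (set_encode S)"]) (auto simp: mem)
  qed
  moreover have "convex_body K"
    by (simp add: K_def convex_body_capped_paraboloid)
  moreover have "translate_of K (T j)" for j
    unfolding translate_of_def T_def by (rule exI[of _ "- t j"]) (rule refl)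
  then have "\<forall>F\<in>range T. translate_of K F" by auto
  ultimately show ?thesis
    by (intro exI[of _ K] exI[of _ "range T"]) auto
qed

end
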